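(* Let $I$ and $\mathcal{A}$ be $2$-categories, and let $F\colon I\to\mathcal{A}$ be a $2$-functor. If $(L,\lambda\colon\Delta L\Rightarrow F)$ is a $2$-limit of $F$, then $(L,\lambda)$ is $2$-terminal in the strict-slice $\Delta\downarrow_s F$ of $2$-cones over $F$.
   Context: $2$-categories and $2$-functors are strict; $*$ denotes horizontal composition (and whiskering) of $2$-morphisms and juxtaposition denotes vertical composition. A $2$-natural transformation $\mu\colon F\Rightarrow G$ between $2$-functors $F,G\colon I\to\mathcal{A}$ consists of morphisms $\mu_i\colon Fi\to Gi$ with $(Gf)\mu_i=\mu_j(Ff)$ for every $f\colon i\to j$ in $I$ and $G\alpha*\mu_i=\mu_j*F\alpha$ for every $2$-morphism $\alpha\colon f\Rightarrow g$ in $I$. A modification $\varphi\colon\mu\to\nu$ consists of $2$-morphisms $\varphi_i\colon\mu_i\Rightarrow\nu_i$ with $Gf*\varphi_i=\varphi_j*Ff$ for every $f\colon i\to j$. $[I,\mathcal{A}]$ is the $2$-category of $2$-functors $I\to\mathcal{A}$, $2$-natural transformations and modifications. $\Delta\colon\mathcal{A}\to[I,\mathcal{A}]$ sends $X$ to the constant $2$-functor $\Delta X$. A $2$-cone over $F$ with summit $X$ is a $2$-natural transformation $\Delta X\Rightarrow F$. A $2$-limit of $F$ is an object $L\in\mathcal{A}$ with a $2$-cone $\lambda\colon\Delta L\Rightarrow F$ such that for each $X\in\mathcal{A}$ the functor $\lambda_*\circ\Delta\colon\mathcal{A}(X,L)\to[I,\mathcal{A}](\Delta X,F)$, given by post-composition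 with $\lambda$, is an isomorphism of categories. The strict-slice $\Delta\downarrow_s F$ is the $2$-category whose objects are pairs $(X,\mu)$ with $X\in\mathcal{A}$ and $\mu\colon\Delta X\Rightarrow F$ a $2$-cone; whose morphisms $(X,\mu)\to(Y,\nu)$ are morphisms $f\colon X\to Y$ of $\mathcal{A}$ with $\nu\Delta f=\mu$; and whose $2$-morphisms $f\Rightarrow g$ between $f,g\colon(X,\mu)\to(Y,\nu)$ are $2$-morphisms $\alpha\colon f\Rightarrow g$ of $\mathcal{A}$ with $\nu*\Delta\alpha=\mathrm{id}_\mu$. An object $L$ of a $2$-category $\mathcal{B}$ is $2$-terminal if for all $X\in\mathcal{B}$ the category $\mathcal{B}(X,L)$ is isomorphic to the terminal category $\mathbb{1}$. *)

theory Defs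
  imports "HOL-Library.FuncSet"
begin

text \<open>
  Operations are total functions that are meaningful only on the carriers \<open>Ob\<close>, \<open>Ar\<close>
  (and on composable pairs).  \<open>Cmp C g f\<close> is the composite \<open>g f\<close>, i.e. first \<open>f\<close>, then \<open>g\<close>.
\<close>

record ('o, 'a) cat =
  Ob :: "'o set"
  Ar :: "'a set"
  ADom :: "'a \<Rightarrow> 'o"
  ACod :: "'a \<Rightarrow> 'o"
  AId :: "'o \<Rightarrow> 'a"
  Cmp :: "'a \<Rightarrow> 'a \<Rightarrow> 'a"

definition category :: "('o, 'a) cat \<Rightarrow> bool" where
  "category C \<longleftrightarrow>
     (\<forall>f \<in> Ar C. ADom C f \<in> Ob C \<and> ACod C f \<in> Ob C) \<and>
     (\<forall>X \<in> Ob C. AId C X \<in> Ar C \<and> ADom C (AId C X) = X \<and> ACod C (AId C X) = X) \<and>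
     (\<forall>f \<in> Ar C. \<forall>g \<in> Ar C. ADom C g = ACod C f \<longrightarrow>
        Cmp C g f \<in> Ar C \<and> ADom C (Cmp C g f) = ADom C f \<and> ACod C (Cmp C g f) = ACod C g) \<and>
     (\<forall>f \<in> Ar C. Cmp C f (AId C (ADom C f)) = f \<and> Cmp C (AId C (ACod C f)) f = f) \<and>
     (\<forall>f \<in> Ar C. \<forall>g \<in> Ar C. \<forall>h \<in> Ar C. ADom C g = ACod C f \<longrightarrow> ADom C h = ACod C g \<longrightarrow>
        Cmp C h (Cmp C g f) = Cmp C (Cmp C h g) f)"

record ('o, 'a, 'p, 'b) cfunctor =
  on_ob :: "'o \<Rightarrow> 'p"
  on_ar :: "'a \<Rightarrow> 'b"

definition is_functor ::
  "('o, 'a) cat \<Rightarrow> ('p, 'b) cat \<Rightarrow> ('o, 'a, 'p, 'b) cfunctor \<Rightarrow> bool" where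
  "is_functor C D T \<longleftrightarrow>
     (\<forall>X \<in> Ob C. on_ob T X \<in> Ob D) \<and>
     (\<forall>f \<in> Ar C. on_ar T f \<in> Ar D \<and>
        ADom D (on_ar T f) = on_ob T (ADom C f) \<and> ACod D (on_ar T f) = on_ob T (ACod C f)) \<and>
     (\<forall>X \<in> Ob C. on_ar T (AId C X) = AId D (on_ob T X)) \<and>
     (\<forall>f \<in> Ar C. \<forall>g \<in> Ar C. ADom C g = ACod C f \<longrightarrow>
        on_ar T (Cmp C g f) = Cmp D (on_ar T g) (on_ar T f))"

definition functor_comp ::
  "('p, 'b, 'q, 'c) cfunctor \<Rightarrow> ('o, 'a, 'p, 'b) cfunctor \<Rightarrow> ('o, 'a, 'q, 'c) cfunctor" where
  "functor_comp S T = \<lparr>on_ob = on_ob S \<circ> on_ob T, on_ar = on_ar S \<circ> on_ar T\<rparr>"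

text \<open>
  Values of a functor outside the carriers carry no information, so equality with the identity
  functor is tested on the carriers.
\<close>

definition is_identity_functor :: "('o, 'a) cat \<Rightarrow> ('o, 'a, 'o, 'a) cfunctor \<Rightarrow> bool" where
  "is_identity_functor C T \<longleftrightarrow> (\<forall>X \<in> Ob C. on_ob T X = X) \<and> (\<forall>f \<in> Ar C. on_ar T f = f)"

definition is_cat_iso ::
  "('o, 'a) cat \<Rightarrow> ('p, 'b) cat \<Rightarrow> ('o, 'a, 'p, 'b) cfunctor \<Rightarrow> bool" where
  "is_cat_iso C D T \<longleftrightarrow> is_functor C D T \<and>
     (\<exists>S. is_functor D C S \<and> is_identity_functor C (functor_comp S T) \<and>
          is_identity_functor D (functor_comp T S))"

definition isomorphic_cats :: "('o, 'a) cat \<Rightarrow> ('p, 'b) cat \<Rightarrow> bool" where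
  "isomorphic_cats C D \<longleftrightarrow> (\<exists>T. is_cat_iso C D T)"

definition terminal_cat :: "(unit, unit) cat" where
  "terminal_cat = \<lparr>Ob = UNIV, Ar = UNIV, ADom = (\<lambda>_. ()), ACod = (\<lambda>_. ()),
     AId = (\<lambda>_. ()), Cmp = (\<lambda>_ _. ())\<rparr>"

text \<open>
  \<open>Comp A g f\<close> is the composite \<open>g f\<close> of morphisms; \<open>VComp A \<beta> \<alpha>\<close> is the vertical composite
  \<open>\<beta> \<alpha>\<close>; \<open>HComp A \<beta> \<alpha>\<close> is the horizontal composite \<open>\<beta> * \<alpha>\<close>.  Whiskering with a morphism
  is horizontal composition with its identity 2-morphism.
\<close>

record ('o, 'm, 'c) two_cat =
  Obj :: "'o set"
  Mor :: "'m set"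
  Cell :: "'c set"
  Dom :: "'m \<Rightarrow> 'o"
  Cod :: "'m \<Rightarrow> 'o"
  Src :: "'c \<Rightarrow> 'm"
  Tgt :: "'c \<Rightarrow> 'm"
  IdM :: "'o \<Rightarrow> 'm"
  IdC :: "'m \<Rightarrow> 'c"
  Comp :: "'m \<Rightarrow> 'm \<Rightarrow> 'm"
  VComp :: "'c \<Rightarrow> 'c \<Rightarrow> 'c"
  HComp :: "'c \<Rightarrow> 'c \<Rightarrow> 'c"

definition underlying_cat :: "('o, 'm, 'c) two_cat \<Rightarrow> ('o, 'm) cat" where
  "underlying_cat A = \<lparr>Ob = Obj A, Ar = Mor A, ADom = Dom A, ACod = Cod A,
     AId = IdM A, Cmp = Comp A\<rparr>"

definition homs :: "('o, 'm, 'c) two_cat \<Rightarrow> 'o \<Rightarrow> 'o \<Rightarrow> 'm set" where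
  "homs A X Y = {f \<in> Mor A. Dom A f = X \<and> Cod A f = Y}"

definition cells :: "('o, 'm, 'c) two_cat \<Rightarrow> 'm \<Rightarrow> 'm \<Rightarrow> 'c set" where
  "cells A f g = {\<alpha> \<in> Cell A. Src A \<alpha> = f \<and> Tgt A \<alpha> = g}"

definition hom_cat :: "('o, 'm, 'c) two_cat \<Rightarrow> 'o \<Rightarrow> 'o \<Rightarrow> ('m, 'c) cat" where
  "hom_cat A X Y = \<lparr>Ob = homs A X Y,
     Ar = {\<alpha> \<in> Cell A. Src A \<alpha> \<in> homs A X Y \<and> Tgt A \<alpha> \<in> homs A X Y},
     ADom = Src A, ACod = Tgt A, AId = IdC A, Cmp = VComp A\<rparr>"

definition two_category :: "('o, 'm, 'c) two_cat \<Rightarrow> bool" where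
  "two_category A \<longleftrightarrow>
     category (underlying_cat A) \<and>
     (\<forall>\<alpha> \<in> Cell A. \<exists>X \<in> Obj A. \<exists>Y \<in> Obj A. Src A \<alpha> \<in> homs A X Y \<and> Tgt A \<alpha> \<in> homs A X Y) \<and>
     (\<forall>X \<in> Obj A. \<forall>Y \<in> Obj A. category (hom_cat A X Y)) \<and>
     (\<forall>X \<in> Obj A. \<forall>Y \<in> Obj A. \<forall>Z \<in> Obj A.
        \<forall>f \<in> homs A X Y. \<forall>f' \<in> homs A X Y. \<forall>g \<in> homs A Y Z. \<forall>g' \<in> homs A Y Z.
        \<forall>\<alpha> \<in> cells A f f'. \<forall>\<beta> \<in> cells A g g'.
          HComp A \<beta> \<alpha> \<in> cells A (Comp A g f) (Comp A g' f')) \<and>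
     (\<forall>f \<in> Mor A. \<forall>g \<in> Mor A. Dom A g = Cod A f \<longrightarrow>
        HComp A (IdC A g) (IdC A f) = IdC A (Comp A g f)) \<and>
     (\<forall>\<alpha> \<in> Cell A. \<forall>\<alpha>' \<in> Cell A. \<forall>\<beta> \<in> Cell A. \<forall>\<beta>' \<in> Cell A.
        Src A \<alpha>' = Tgt A \<alpha> \<longrightarrow> Src A \<beta>' = Tgt A \<beta> \<longrightarrow> Dom A (Src A \<beta>) = Cod A (Src A \<alpha>) \<longrightarrow>
        HComp A (VComp A \<beta>' \<beta>) (VComp A \<alpha>' \<alpha>) = VComp A (HComp A \<beta>' \<alpha>') (HComp A \<beta> \<alpha>)) \<and>
     (\<forall>\<alpha> \<in> Cell A.
        HComp A \<alpha> (IdC A (IdM A (Dom A (Src A \<alpha>)))) = \<alpha> \<and>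
        HComp A (IdC A (IdM A (Cod A (Src A \<alpha>)))) \<alpha> = \<alpha>) \<and>
     (\<forall>\<alpha> \<in> Cell A. \<forall>\<beta> \<in> Cell A. \<forall>\<gamma> \<in> Cell A.
        Dom A (Src A \<beta>) = Cod A (Src A \<alpha>) \<longrightarrow> Dom A (Src A \<gamma>) = Cod A (Src A \<beta>) \<longrightarrow>
        HComp A \<gamma> (HComp A \<beta> \<alpha>) = HComp A (HComp A \<gamma> \<beta>) \<alpha>)"

definition two_terminal :: "('o, 'm, 'c) two_cat \<Rightarrow> 'o \<Rightarrow> bool" where
  "two_terminal B L \<longleftrightarrow> L \<in> Obj B \<and>
     (\<forall>X \<in> Obj B. isomorphic_cats (hom_cat B X L) terminal_cat)"

text \<open>
  2-functors are themselves objects of the 2-category \<open>[I, A]\<close>, so equality of 2-functors must be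
  equality of the data on the carriers.  This is achieved by requiring the three maps to be
  extensional, i.e. \<open>undefined\<close> outside the carriers; the same device is used for the families
  underlying 2-natural transformations and modifications.
\<close>

record ('o, 'm, 'c, 'p, 'n, 'd) two_fun =
  FObj :: "'o \<Rightarrow> 'p"
  FMor :: "'m \<Rightarrow> 'n"
  FCell :: "'c \<Rightarrow> 'd"

definition fun_underlying :: "('o, 'm, 'c, 'p, 'n, 'd) two_fun \<Rightarrow> ('o, 'm, 'p, 'n) cfunctor" where
  "fun_underlying T = \<lparr>on_ob = FObj T, on_ar = FMor T\<rparr>"

text \<open>For every pair of objects \<open>X, Y\<close> this acts from \<open>A(X, Y)\<close> to \<open>B(T X, T Y)\<close>.\<close>

definition fun_on_homs :: "('o, 'm, 'c, 'p, 'n, 'd) two_fun \<Rightarrow> ('m, 'c, 'n, 'd) cfunctor" where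
  "fun_on_homs T = \<lparr>on_ob = FMor T, on_ar = FCell T\<rparr>"

definition two_functor ::
  "('o, 'm, 'c) two_cat \<Rightarrow> ('p, 'n, 'd) two_cat \<Rightarrow> ('o, 'm, 'c, 'p, 'n, 'd) two_fun \<Rightarrow> bool" where
  "two_functor A B T \<longleftrightarrow>
     FObj T \<in> extensional (Obj A) \<and> FMor T \<in> extensional (Mor A) \<and>
     FCell T \<in> extensional (Cell A) \<and>
     is_functor (underlying_cat A) (underlying_cat B) (fun_underlying T) \<and>
     (\<forall>X \<in> Obj A. \<forall>Y \<in> Obj A.
        is_functor (hom_cat A X Y) (hom_cat B (FObj T X) (FObj T Y)) (fun_on_homs T)) \<and>
     (\<forall>\<alpha> \<in> Cell A. \<forall>\<beta> \<in> Cell A. Dom A (Src A \<beta>) = Cod A (Src A \<alpha>) \<longrightarrow>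
        FCell T (HComp A \<beta> \<alpha>) = HComp B (FCell T \<beta>) (FCell T \<alpha>))"

text \<open>Data \<open>body\<close> tagged with a source and a target, so that these can be read off.\<close>

datatype ('x, 'y) arrow = Arrow (source: 'x) (body: 'y) (target: 'x)

definition two_natural ::
  "('oi, 'mi, 'ci) two_cat \<Rightarrow> ('o, 'm, 'c) two_cat \<Rightarrow>
   ('oi, 'mi, 'ci, 'o, 'm, 'c) two_fun \<Rightarrow> ('oi, 'mi, 'ci, 'o, 'm, 'c) two_fun \<Rightarrow>
   ('oi \<Rightarrow> 'm) \<Rightarrow> bool" where
  "two_natural I A F G \<mu> \<longleftrightarrow>
     \<mu> \<in> extensional (Obj I) \<and>
     (\<forall>i \<in> Obj I. \<mu> i \<in> homs A (FObj F i) (FObj G i)) \<and>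
     (\<forall>i \<in> Obj I. \<forall>j \<in> Obj I. \<forall>f \<in> homs I i j.
        Comp A (FMor G f) (\<mu> i) = Comp A (\<mu> j) (FMor F f)) \<and>
     (\<forall>i \<in> Obj I. \<forall>j \<in> Obj I. \<forall>f \<in> homs I i j. \<forall>g \<in> homs I i j. \<forall>\<alpha> \<in> cells I f g.
        HComp A (FCell G \<alpha>) (IdC A (\<mu> i)) = HComp A (IdC A (\<mu> j)) (FCell F \<alpha>))"

definition modification ::
  "('oi, 'mi, 'ci) two_cat \<Rightarrow> ('o, 'm, 'c) two_cat \<Rightarrow>
   ('oi, 'mi, 'ci, 'o, 'm, 'c) two_fun \<Rightarrow> ('oi, 'mi, 'ci, 'o, 'm, 'c) two_fun \<Rightarrow>
   ('oi \<Rightarrow> 'm) \<Rightarrow> ('oi \<Rightarrow> 'm) \<Rightarrow> ('oi \<Rightarrow> 'c) \<Rightarrow> bool" where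
  "modification I A F G \<mu> \<nu> \<phi> \<longleftrightarrow>
     \<phi> \<in> extensional (Obj I) \<and>
     (\<forall>i \<in> Obj I. \<phi> i \<in> cells A (\<mu> i) (\<nu> i)) \<and>
     (\<forall>i \<in> Obj I. \<forall>j \<in> Obj I. \<forall>f \<in> homs I i j.
        HComp A (IdC A (FMor G f)) (\<phi> i) = HComp A (\<phi> j) (IdC A (FMor F f)))"

type_synonym ('oi, 'mi, 'ci, 'o, 'm, 'c) nat_trans =
  "(('oi, 'mi, 'ci, 'o, 'm, 'c) two_fun, 'oi \<Rightarrow> 'm) arrow"

type_synonym ('oi, 'mi, 'ci, 'o, 'm, 'c) modif =
  "(('oi, 'mi, 'ci, 'o, 'm, 'c) nat_trans, 'oi \<Rightarrow> 'c) arrow"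

type_synonym ('oi, 'mi, 'ci, 'o, 'm, 'c) fun_two_cat =
  "(('oi, 'mi, 'ci, 'o, 'm, 'c) two_fun,
    ('oi, 'mi, 'ci, 'o, 'm, 'c) nat_trans,
    ('oi, 'mi, 'ci, 'o, 'm, 'c) modif) two_cat"

definition nat_comp ::
  "('oi, 'mi, 'ci) two_cat \<Rightarrow> ('o, 'm, 'c) two_cat \<Rightarrow>
   ('oi, 'mi, 'ci, 'o, 'm, 'c) nat_trans \<Rightarrow> ('oi, 'mi, 'ci, 'o, 'm, 'c) nat_trans \<Rightarrow>
   ('oi, 'mi, 'ci, 'o, 'm, 'c) nat_trans" where
  "nat_comp I A \<nu> \<mu> =
     Arrow (source \<mu>) (\<lambda>i\<in>Obj I. Comp A (body \<nu> i) (body \<mu> i)) (target \<nu>)"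

definition functor_2cat ::
  "('oi, 'mi, 'ci) two_cat \<Rightarrow> ('o, 'm, 'c) two_cat \<Rightarrow>
   ('oi, 'mi, 'ci, 'o, 'm, 'c) fun_two_cat" where
  "functor_2cat I A = \<lparr>
     Obj = {F. two_functor I A F},
     Mor = {Arrow F \<mu> G | F \<mu> G.
              two_functor I A F \<and> two_functor I A G \<and> two_natural I A F G \<mu>},
     Cell = {Arrow (Arrow F \<mu> G) \<phi> (Arrow F \<nu> G) | F G \<mu> \<nu> \<phi>.
              two_functor I A F \<and> two_functor I A G \<and> two_natural I A F G \<mu> \<and>
              two_natural I A F G \<nu> \<and> modification I A F G \<mu> \<nu> \<phi>},
     Dom = source, Cod = target, Src = source, Tgt = target,
     IdM = (\<lambda>F. Arrow F (\<lambda>i\<in>Obj I. IdM A (FObj F i)) F),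
     IdC = (\<lambda>\<mu>. Arrow \<mu> (\<lambda>i\<in>Obj I. IdC A (body \<mu> i)) \<mu>),
     Comp = nat_comp I A,
     VComp = (\<lambda>\<psi> \<phi>. Arrow (source \<phi>) (\<lambda>i\<in>Obj I. VComp A (body \<psi> i) (body \<phi> i)) (target \<psi>)),
     HComp = (\<lambda>\<psi> \<phi>. Arrow (nat_comp I A (source \<psi>) (source \<phi>))
                (\<lambda>i\<in>Obj I. HComp A (body \<psi> i) (body \<phi> i))
                (nat_comp I A (target \<psi>) (target \<phi>)))\<rparr>"

definition const_fun ::
  "('oi, 'mi, 'ci) two_cat \<Rightarrow> ('o, 'm, 'c) two_cat \<Rightarrow> 'o \<Rightarrow>
   ('oi, 'mi, 'ci, 'o, 'm, 'c) two_fun" where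
  "const_fun I A X = \<lparr>FObj = (\<lambda>i\<in>Obj I. X), FMor = (\<lambda>f\<in>Mor I. IdM A X),
     FCell = (\<lambda>\<alpha>\<in>Cell I. IdC A (IdM A X))\<rparr>"

definition const_nat ::
  "('oi, 'mi, 'ci) two_cat \<Rightarrow> ('o, 'm, 'c) two_cat \<Rightarrow> 'm \<Rightarrow>
   ('oi, 'mi, 'ci, 'o, 'm, 'c) nat_trans" where
  "const_nat I A f = Arrow (const_fun I A (Dom A f)) (\<lambda>i\<in>Obj I. f) (const_fun I A (Cod A f))"

definition const_modif ::
  "('oi, 'mi, 'ci) two_cat \<Rightarrow> ('o, 'm, 'c) two_cat \<Rightarrow> 'c \<Rightarrow>
   ('oi, 'mi, 'ci, 'o, 'm, 'c) modif" where
  "const_modif I A \<alpha> =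
     Arrow (const_nat I A (Src A \<alpha>)) (\<lambda>i\<in>Obj I. \<alpha>) (const_nat I A (Tgt A \<alpha>))"

definition diagonal ::
  "('oi, 'mi, 'ci) two_cat \<Rightarrow> ('o, 'm, 'c) two_cat \<Rightarrow>
   ('o, 'm, 'c, ('oi, 'mi, 'ci, 'o, 'm, 'c) two_fun,
    ('oi, 'mi, 'ci, 'o, 'm, 'c) nat_trans, ('oi, 'mi, 'ci, 'o, 'm, 'c) modif) two_fun" where
  "diagonal I A = \<lparr>FObj = restrict (const_fun I A) (Obj A),
     FMor = restrict (const_nat I A) (Mor A),
     FCell = restrict (const_modif I A) (Cell A)\<rparr>"

definition two_cones ::
  "('oi, 'mi, 'ci) two_cat \<Rightarrow> ('o, 'm, 'c) two_cat \<Rightarrow>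
   ('oi, 'mi, 'ci, 'o, 'm, 'c) two_fun \<Rightarrow> 'o \<Rightarrow> ('oi, 'mi, 'ci, 'o, 'm, 'c) nat_trans set" where
  "two_cones I A F X = homs (functor_2cat I A) (FObj (diagonal I A) X) F"

text \<open>Post-composition with \<open>k : Y \<rightarrow> Z\<close> as a functor \<open>B(W, Y) \<rightarrow> B(W, Z)\<close>, for every \<open>W\<close>.\<close>

definition post_comp :: "('o, 'm, 'c) two_cat \<Rightarrow> 'm \<Rightarrow> ('m, 'c, 'm, 'c) cfunctor" where
  "post_comp B k = \<lparr>on_ob = (\<lambda>f. Comp B k f), on_ar = (\<lambda>\<alpha>. HComp B (IdC B k) \<alpha>)\<rparr>"

definition two_limit ::
  "('oi, 'mi, 'ci) two_cat \<Rightarrow> ('o, 'm, 'c) two_cat \<Rightarrow>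
   ('oi, 'mi, 'ci, 'o, 'm, 'c) two_fun \<Rightarrow> 'o \<Rightarrow> ('oi, 'mi, 'ci, 'o, 'm, 'c) nat_trans \<Rightarrow> bool" where
  "two_limit I A F L lam \<longleftrightarrow> L \<in> Obj A \<and> lam \<in> two_cones I A F L \<and>
     (\<forall>X \<in> Obj A.
        is_cat_iso (hom_cat A X L) (hom_cat (functor_2cat I A) (FObj (diagonal I A) X) F)
          (functor_comp (post_comp (functor_2cat I A) lam) (fun_on_homs (diagonal I A))))"

type_synonym ('oi, 'mi, 'ci, 'o, 'm, 'c) slice_obj =
  "'o \<times> ('oi, 'mi, 'ci, 'o, 'm, 'c) nat_trans"

type_synonym ('oi, 'mi, 'ci, 'o, 'm, 'c) slice_mor =
  "(('oi, 'mi, 'ci, 'o, 'm, 'c) slice_obj, 'm) arrow"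

type_synonym ('oi, 'mi, 'ci, 'o, 'm, 'c) slice_cell =
  "(('oi, 'mi, 'ci, 'o, 'm, 'c) slice_mor, 'c) arrow"

definition slice_comp ::
  "('o, 'm, 'c) two_cat \<Rightarrow>
   ('oi, 'mi, 'ci, 'o, 'm, 'c) slice_mor \<Rightarrow> ('oi, 'mi, 'ci, 'o, 'm, 'c) slice_mor \<Rightarrow>
   ('oi, 'mi, 'ci, 'o, 'm, 'c) slice_mor" where
  "slice_comp A q p = Arrow (source p) (Comp A (body q) (body p)) (target q)"

definition slice_mors ::
  "('oi, 'mi, 'ci) two_cat \<Rightarrow> ('o, 'm, 'c) two_cat \<Rightarrow>
   ('oi, 'mi, 'ci, 'o, 'm, 'c) two_fun \<Rightarrow> ('oi, 'mi, 'ci, 'o, 'm, 'c) slice_mor set" where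
  "slice_mors I A F =
     {Arrow (X, \<mu>) f (Y, \<nu>) | X \<mu> f Y \<nu>.
        X \<in> Obj A \<and> \<mu> \<in> two_cones I A F X \<and> Y \<in> Obj A \<and> \<nu> \<in> two_cones I A F Y \<and>
        f \<in> homs A X Y \<and> Comp (functor_2cat I A) \<nu> (FMor (diagonal I A) f) = \<mu>}"

definition strict_slice ::
  "('oi, 'mi, 'ci) two_cat \<Rightarrow> ('o, 'm, 'c) two_cat \<Rightarrow>
   ('oi, 'mi, 'ci, 'o, 'm, 'c) two_fun \<Rightarrow>
   (('oi, 'mi, 'ci, 'o, 'm, 'c) slice_obj, ('oi, 'mi, 'ci, 'o, 'm, 'c) slice_mor,
    ('oi, 'mi, 'ci, 'o, 'm, 'c) slice_cell) two_cat" where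
  "strict_slice I A F = \<lparr>
     Obj = {(X, \<mu>). X \<in> Obj A \<and> \<mu> \<in> two_cones I A F X},
     Mor = slice_mors I A F,
     Cell = {Arrow (Arrow (X, \<mu>) f (Y, \<nu>)) \<alpha> (Arrow (X, \<mu>) g (Y, \<nu>)) | X \<mu> f g Y \<nu> \<alpha>.
        Arrow (X, \<mu>) f (Y, \<nu>) \<in> slice_mors I A F \<and> Arrow (X, \<mu>) g (Y, \<nu>) \<in> slice_mors I A F \<and>
        \<alpha> \<in> cells A f g \<and>
        HComp (functor_2cat I A) (IdC (functor_2cat I A) \<nu>) (FCell (diagonal I A) \<alpha>)
          = IdC (functor_2cat I A) \<mu>},
     Dom = source, Cod = target, Src = source, Tgt = target,
     IdM = (\<lambda>(X, \<mu>). Arrow (X, \<mu>) (IdM A X) (X, \<mu>)),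
     IdC = (\<lambda>p. Arrow p (IdC A (body p)) p),
     Comp = slice_comp A,
     VComp = (\<lambda>\<beta> \<alpha>. Arrow (source \<alpha>) (VComp A (body \<beta>) (body \<alpha>)) (target \<beta>)),
     HComp = (\<lambda>\<beta> \<alpha>. Arrow (slice_comp A (source \<beta>) (source \<alpha>)) (HComp A (body \<beta>) (body \<alpha>))
                (slice_comp A (target \<beta>) (target \<alpha>)))\<rparr>"

end

theory Submission
  imports Defs
begin

text \<open>
  An object of the slice hom-category from \<open>(X, \<mu>)\<close> to \<open>(L, \<lambda>)\<close> is a preimage of \<open>\<mu>\<close> under the
  functor \<open>\<lambda>\<^sub>* \<circ> \<Delta>\<close>, and an arrow is a preimage of \<open>id\<^sub>\<mu>\<close>.  As this functor is an isomorphism, there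
  is exactly one of each, namely some \<open>f\<close> and, by functoriality, \<open>id\<^sub>f\<close>.
\<close>

text \<open>The equations on \<open>a\<close> are what makes the constant maps at \<open>p\<close>
  and \<open>a\<close> a functor out of \<open>terminal_cat\<close>. They stand in for
  \<open>category C\<close>, so the slice never has to be shown to be a 2-category.\<close>

lemma isomorphic_terminal_catI:
  assumes "Ob C = {p}" "Ar C = {a}" "ADom C a = p" "ACod C a = p" "AId C p = a" "Cmp C a a = a"
  shows "isomorphic_cats C terminal_cat"
  unfolding isomorphic_cats_def is_cat_iso_def
proof (intro exI conjI)
  let ?T = "\<lparr>on_ob = \<lambda>_. (), on_ar = \<lambda>_. ()\<rparr>"
  let ?S = "\<lparr>on_ob = \<lambda>_. p, on_ar = \<lambda>_. a\<rparr>"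
  show "is_functor C terminal_cat ?T"
    by (simp add: is_functor_def terminal_cat_def)
  show "is_functor terminal_cat C ?S"
    using assms by (simp add: is_functor_def terminal_cat_def)
  show "is_identity_functor C (functor_comp ?S ?T)"
    using assms by (simp add: is_identity_functor_def functor_comp_def)
  show "is_identity_functor terminal_cat (functor_comp ?T ?S)"
    by (simp add: is_identity_functor_def functor_comp_def)
qed

text \<open>The maps of the inverse functor are two-sided inverses on the carriers. Below,
  surjectivity gives existence of a preimage and injectivity its uniqueness.\<close>

lemma is_cat_iso_bij_betw:
  assumes "is_cat_iso C D T"
  shows is_cat_iso_bij_betw_Ob: "bij_betw (on_ob T) (Ob C) (Ob D)"
    and is_cat_iso_bij_betw_Ar: "bij_betw (on_ar T) (Ar C) (Ar D)"
proof -
  obtain S where T: "is_functor C D T" and S: "is_functor D C S"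
    and ST: "is_identity_functor C (functor_comp S T)"
    and TS: "is_identity_functor D (functor_comp T S)"
    using assms unfolding is_cat_iso_def by blast
  show "bij_betw (on_ob T) (Ob C) (Ob D)"
    by (rule bij_betw_byWitness[where f' = "on_ob S"])
      (use T S ST TS in \<open>auto simp: is_functor_def is_identity_functor_def functor_comp_def\<close>)
  show "bij_betw (on_ar T) (Ar C) (Ar D)"
    by (rule bij_betw_byWitness[where f' = "on_ar S"])
      (use T S ST TS in \<open>auto simp: is_functor_def is_identity_functor_def functor_comp_def\<close>)
qed

theorem proposition2p11:
  fixes I :: "('oi, 'mi, 'ci) two_cat"
    and A :: "('o, 'm, 'c) two_cat"
    and F :: "('oi, 'mi, 'ci, 'o, 'm, 'c) two_fun"
    and L :: 'o
    and lam :: "('oi, 'mi, 'ci, 'o, 'm, 'c) nat_trans"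
  assumes "two_category I"
    and "two_category A"
    and "two_functor I A F"
    and "two_limit I A F L lam"
  shows "two_terminal (strict_slice I A F) (L, lam)"
  unfolding two_terminal_def
proof (intro conjI ballI)
  have L: "L \<in> Obj A" and lam: "lam \<in> two_cones I A F L"
    using assms(4) by (auto simp: two_limit_def)
  then show "(L, lam) \<in> Obj (strict_slice I A F)"
    by (simp add: strict_slice_def)
  fix P assume "P \<in> Obj (strict_slice I A F)"
  then obtain X \<mu> where P: "P = (X, \<mu>)" and X: "X \<in> Obj A" and \<mu>: "\<mu> \<in> two_cones I A F X"
    by (auto simp: strict_slice_def)
  let ?B = "functor_2cat I A"
  let ?C = "hom_cat A X L"
  let ?D = "hom_cat ?B (FObj (diagonal I A) X) F"
  define T where "T = functor_comp (post_comp ?B lam) (fun_on_homs (diagonal I A))"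
  \<comment> \<open>In this form, the conditions defining morphisms and 2-morphisms of the slice
    into \<open>(L, lam)\<close> read \<open>on_ob T g = \<mu>\<close> and
    \<open>on_ar T \<alpha> = IdC ?B \<mu>\<close>.\<close>
  have T_ob: "on_ob T f = Comp ?B lam (FMor (diagonal I A) f)" for f
    by (simp add: T_def functor_comp_def post_comp_def fun_on_homs_def)
  have T_ar: "on_ar T \<alpha> = HComp ?B (IdC ?B lam) (FCell (diagonal I A) \<alpha>)" for \<alpha>
    by (simp add: T_def functor_comp_def post_comp_def fun_on_homs_def)
  have iso: "is_cat_iso ?C ?D T"
    using assms(4) X by (simp add: two_limit_def T_def)
  have "\<mu> \<in> Ob ?D"
    using \<mu> by (simp add: two_cones_def hom_cat_def)
  then obtain f where f: "f \<in> homs A X L" and Tf: "on_ob T f = \<mu>"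
    using is_cat_iso_bij_betw_Ob[OF iso] by (force simp: bij_betw_def hom_cat_def)
  have f_unique: "g = f" if "g \<in> homs A X L" "on_ob T g = \<mu>" for g
    using is_cat_iso_bij_betw_Ob[OF iso] that f Tf
    by (auto simp: bij_betw_def hom_cat_def dest: inj_onD)
  have C: "category ?C"
    using assms(2) X L by (simp add: two_category_def)
  have id_f: "IdC A f \<in> cells A f f"
    using C f by (simp add: category_def hom_cat_def cells_def)
  \<comment> \<open>The source of \<open>IdC A f\<close> is \<open>f\<close>, so its right unit law
    says that it is idempotent under vertical composition.\<close>
  have "Cmp ?C (IdC A f) (AId ?C (ADom ?C (IdC A f))) = IdC A f"
  proof -
    have "IdC A f \<in> Ar ?C"
      using id_f f by (simp add: hom_cat_def cells_def)
    then show ?thesis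
      using C unfolding category_def by blast
  qed
  then have id_id: "VComp A (IdC A f) (IdC A f) = IdC A f"
    using id_f by (simp add: hom_cat_def cells_def)
  \<comment> \<open>\<open>T\<close> preserves identities and sends \<open>f\<close> to \<mu>; hence
    \<open>IdC A f\<close> is a 2-morphism of the slice.\<close>
  have T_id: "on_ar T (IdC A f) = IdC ?B \<mu>"
    using iso f Tf by (simp add: is_cat_iso_def is_functor_def hom_cat_def)
  have id_unique: "\<alpha> = IdC A f" if "\<alpha> \<in> cells A f f" "on_ar T \<alpha> = IdC ?B \<mu>" for \<alpha>
  proof -
    have "inj_on (on_ar T) (Ar ?C)"
      using is_cat_iso_bij_betw_Ar[OF iso] by (simp add: bij_betw_def)
    moreover have "\<alpha> \<in> Ar ?C" "IdC A f \<in> Ar ?C"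
      using that(1) id_f f by (auto simp: hom_cat_def cells_def)
    ultimately show ?thesis
      using that(2) T_id by (metis inj_onD)
  qed
  let ?p = "Arrow (X, \<mu>) f (L, lam)"
  have slice_mors_iff: "Arrow (X, \<mu>) g (L, lam) \<in> slice_mors I A F \<longleftrightarrow> g = f" for g
  proof -
    have "Arrow (X, \<mu>) g (L, lam) \<in> slice_mors I A F \<longleftrightarrow> g \<in> homs A X L \<and> on_ob T g = \<mu>"
      using X L \<mu> lam by (auto simp: slice_mors_def T_ob)
    then show ?thesis
      using f Tf f_unique by blast
  qed
  have homs_slice: "homs (strict_slice I A F) (X, \<mu>) (L, lam) = {?p}"
  proof -
    \<comment> \<open>Once the source and target tags are fixed, only the body of \<open>q\<close>
      is free.\<close>
    have "q \<in> slice_mors I A F \<and> source q = (X, \<mu>) \<and> target q = (L, lam) \<longleftrightarrow> q = ?p" for q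
      using slice_mors_iff by (cases q) auto
    then show ?thesis
      by (auto simp: homs_def strict_slice_def)
  qed
  have ar_slice: "Ar (hom_cat (strict_slice I A F) (X, \<mu>) (L, lam)) = {Arrow ?p (IdC A f) ?p}"
  proof -
    \<comment> \<open>By \<open>homs_slice\<close> both ends of a 2-morphism are \<open>?p\<close>,
      so its body runs from \<open>f\<close> to \<open>f\<close>.\<close>
    have "Ar (hom_cat (strict_slice I A F) (X, \<mu>) (L, lam)) =
        {Arrow ?p \<alpha> ?p | \<alpha>. \<alpha> \<in> cells A f f \<and> on_ar T \<alpha> = IdC ?B \<mu>}"
      unfolding hom_cat_def cat.simps homs_slice T_ar
      using slice_mors_iff by (auto simp: strict_slice_def)
    also have "\<dots> = {Arrow ?p (IdC A f) ?p}"
      using id_f T_id id_unique by blast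
    finally show ?thesis .
  qed
  show "isomorphic_cats (hom_cat (strict_slice I A F) P (L, lam)) terminal_cat"
    unfolding P
  proof (rule isomorphic_terminal_catI[OF _ ar_slice])
    show "Ob (hom_cat (strict_slice I A F) (X, \<mu>) (L, lam)) = {?p}"
      by (simp add: hom_cat_def homs_slice)
  \<comment> \<open>Source, target, identity and composite of the single arrow remain; the composite
    is where \<open>id_id\<close> enters.\<close>
  qed (simp_all add: hom_cat_def strict_slice_def id_id)
qed

end
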